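(* Let $(\Omega,\mathcal F,\mathbb P,\theta)$ be a metric dynamical system with time set $\mathbb R$, let $H$ be a separable Hilbert space, and let $A(\omega)$, $\omega\in\Omega$, be a family of linear operators satisfying the standing assumptions listed in the context, with $U$ the linear random dynamical system generated by $\frac{du}{dt}+A(\theta_t\omega)u=0$. Let $F:\Omega\times H\to H$ be a mapping such that $F(\cdot,x)$ is $(\mathcal F,\mathcal B(H))$-measurable for $x\in H$ and $F(\omega,\cdot)$ is Lipschitz continuous for $\omega\in\Omega$ with a Lipschitz constant $L(\omega)$ such that $$\int_a^bL(\theta_s\omega)\,ds<\infty\qquad\text{for }-\infty<a<b<\infty .$$ Then the equation $$\frac{du}{dt}+A(\theta_t\omega)u=F(\theta_t\omega,u),\qquad u(0)=x\in H,$$ has a unique (mild) solution on any interval $[0,T]$ for any $\omega\in\Omega$, which generates a continuous random dynamical system (that is, the solution map $(t,\omega,x)\mapsto\varphi(t,\omega,x)$ is a continuous random dynamical system on $H$).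
   Context: Metric dynamical system: a probability space $(\Omega,\mathcal F,\mathbb P)$ with a measurable flow $\theta:\mathbb R\times\Omega\to\Omega$ ($\theta_0=\mathrm{id}$, $\theta_t\theta_s=\theta_{t+s}$), $\mathbb P$ being invariant and ergodic under $\theta$. Standing assumptions on $A$: $H_1$ is a separable Hilbert space densely and compactly embedded in $H$; $A(\omega)\in L(H_1,H)$; $\omega\mapsto A(\omega)h$ is measurable for each $h\in H_1$; $-A(\omega)$ generates an analytic $C_0$-semigroup on $H$; for each $\omega$, $t\mapsto A(\theta_t\omega)\in L(H_1,H)$ is Hölder continuous with exponent $\rho\in(0,1)$; there is a random variable $k_1\ge0$ with $t\mapsto k_1(\theta_t\omega)$ Hölder continuous such that the resolvent set of $-A(\omega)$ contains $[k_1(\omega),\infty)$. Under these assumptions there is, for each $\omega$, a unique fundamental solution (parabolic evolution operator) $U_\omega(t,s)$, $t\ge s$, of $\frac{du}{dt}+A(\theta_t\omega)u=0$, strongly continuous in $(t,s)$, and $U(t,\omega):=U_\omega(t,0)$ is a linear random dynamical system with $U_\omega(t,s)=U(t-s,\theta_s\omega)$. Mild solution: $u\in C([0,T],H)$ with $u(t)=U(t,\omega)x+\int_0^tU(t-s,\theta_s\omega)F(\theta_s\omega,u(s))\,ds$ for $t\in[0,T]$. Continuous random dynamical system: a $\mathcal B([0,\infty))\otimes\mathcal F\otimes\mathcal B(H)$-measurable map $\varphi:[0,\infty)\times\Omega\times H\to H$ with $\varphi(0,\omega,x)=x$, $\varphi(t+\tau,\omega,x)=\varphi(t,\theta_\tau\omega,\varphi(\tau,\omega,x))$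 for $t,\tau\ge0$, and $x\mapsto\varphi(t,\omega,x)$ continuous.
   Formalization: Adds the hypothesis that s ↦ F(θ_s ω, 0) is integrable on bounded intervals for every ω; without it the claim fails, e.g. for the circle rotation with H = ℝ, A = 0, F(ω,x) = 1/|ω|, L = 0. *)

theory Defs
  imports "HOL-Probability.Probability"
begin

section \<open>Metric dynamical systems and random dynamical systems\<close>

locale metric_dynamical_system = prob_space M
  for M :: "'w measure" and \<theta> :: "real \<Rightarrow> 'w \<Rightarrow> 'w" +
  assumes measurable_flow: "(\<lambda>(t, \<omega>). \<theta> t \<omega>) \<in> borel \<Otimes>\<^sub>M M \<rightarrow>\<^sub>M M"
    and flow_zero: "\<And>\<omega>. \<omega> \<in> space M \<Longrightarrow> \<theta> 0 \<omega> = \<omega>"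
    and flow_add: "\<And>s t \<omega>. \<omega> \<in> space M \<Longrightarrow> \<theta> t (\<theta> s \<omega>) = \<theta> (t + s) \<omega>"
    and invariant: "\<And>t. distr M M (\<theta> t) = M"
    and ergodic: "\<And>E. \<lbrakk>E \<in> sets M; \<And>t. \<theta> t -` E \<inter> space M = E\<rbrakk> \<Longrightarrow>
                    measure M E = 0 \<or> measure M E = 1"

text \<open>The time set is \<open>[0, \<infinity>)\<close>; values at negative times and outside \<open>space M\<close> are
  irrelevant.\<close>

definition continuous_rds ::
    "'w measure \<Rightarrow> (real \<Rightarrow> 'w \<Rightarrow> 'w) \<Rightarrow> (real \<Rightarrow> 'w \<Rightarrow> 'h::topological_space \<Rightarrow> 'h) \<Rightarrow> bool" where
  "continuous_rds M \<theta> \<phi> \<longleftrightarrow>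
     (\<lambda>(t, \<omega>, x). \<phi> t \<omega> x) \<in> restrict_space borel {0..} \<Otimes>\<^sub>M (M \<Otimes>\<^sub>M borel) \<rightarrow>\<^sub>M borel \<and>
     (\<forall>\<omega>\<in>space M. \<forall>x. \<phi> 0 \<omega> x = x) \<and>
     (\<forall>\<omega>\<in>space M. \<forall>t\<ge>0. \<forall>\<tau>\<ge>0. \<forall>x. \<phi> (t + \<tau>) \<omega> x = \<phi> t (\<theta> \<tau> \<omega>) (\<phi> \<tau> \<omega> x)) \<and>
     (\<forall>\<omega>\<in>space M. \<forall>t\<ge>0. continuous_on UNIV (\<phi> t \<omega>))"

definition linear_rds ::
    "'w measure \<Rightarrow> (real \<Rightarrow> 'w \<Rightarrow> 'w) \<Rightarrow> (real \<Rightarrow> 'w \<Rightarrow> 'h::real_normed_vector \<Rightarrow>\<^sub>L 'h) \<Rightarrow> bool" where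
  "linear_rds M \<theta> U \<longleftrightarrow> continuous_rds M \<theta> (\<lambda>t \<omega>. blinfun_apply (U t \<omega>))"


section \<open>Analytic semigroups\<close>

definition c0_semigroup :: "(real \<Rightarrow> 'h::real_normed_vector \<Rightarrow>\<^sub>L 'h) \<Rightarrow> bool" where
  "c0_semigroup S \<longleftrightarrow>
     S 0 = id_blinfun \<and>
     (\<forall>s\<ge>0. \<forall>t\<ge>0. S (s + t) = S s o\<^sub>L S t) \<and>
     (\<forall>x. ((\<lambda>t. S t x) \<longlongrightarrow> x) (at_right 0))"

text \<open>The complexification of a real Hilbert space \<open>'h\<close> is \<open>'h \<times> 'h\<close>, the pair \<open>(x, y)\<close>
  standing for \<open>x + i y\<close>; the product norm is the Hilbert norm of the complexification.\<close>

definition cscale :: "complex \<Rightarrow> 'h::real_vector \<times> 'h \<Rightarrow> 'h \<times> 'h" where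
  "cscale c p = (Re c *\<^sub>R fst p - Im c *\<^sub>R snd p, Re c *\<^sub>R snd p + Im c *\<^sub>R fst p)"

definition sector :: "real \<Rightarrow> complex set" where
  "sector \<delta> = {z. z \<noteq> 0 \<and> \<bar>Arg z\<bar> < \<delta>}"

text \<open>A semigroup is analytic if its complexification extends to a semigroup of complex-linear
  bounded operators on an open sector around the positive half-axis that is strongly continuous
  at 0 and holomorphic in operator norm. Complex differentiability at \<open>z\<close> with derivative \<open>D\<close>
  means that the real derivative is multiplication of \<open>D\<close> by the complex increment.\<close>

definition analytic_semigroup ::
    "(real \<Rightarrow> 'h::{real_inner, banach} \<Rightarrow>\<^sub>L 'h) \<Rightarrow> bool" where
  "analytic_semigroup S \<longleftrightarrow>
     c0_semigroup S \<and>
     (\<exists>\<delta> (Z :: complex \<Rightarrow> ('h \<times> 'h) \<Rightarrow>\<^sub>L ('h \<times> 'h)).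
        0 < \<delta> \<and> \<delta> \<le> pi / 2 \<and>
        (\<forall>t>0. \<forall>x. blinfun_apply (Z (complex_of_real t)) (x, 0) = (S t x, 0)) \<and>
        (\<forall>z\<in>sector \<delta>. \<forall>c p. blinfun_apply (Z z) (cscale c p) = cscale c (blinfun_apply (Z z) p)) \<and>
        (\<forall>z\<in>sector \<delta>. \<forall>w\<in>sector \<delta>. Z (z + w) = Z z o\<^sub>L Z w) \<and>
        (\<forall>p. ((\<lambda>z. blinfun_apply (Z z) p) \<longlongrightarrow> p) (at 0 within sector \<delta>)) \<and>
        (\<forall>z\<in>sector \<delta>. \<exists>D. (Z has_derivative (\<lambda>h. Blinfun (cscale h) o\<^sub>L D)) (at z)))"


section \<open>Operators with a fixed domain\<close>

text \<open>The space \<open>H\<^sub>1\<close> is given by its embedding \<open>j\<close> into \<open>H\<close>. A bounded operator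
  \<open>B :: 'h1 \<Rightarrow>\<^sub>L 'h\<close> stands for the unbounded operator \<open>j v \<mapsto> B v\<close> on \<open>H\<close> with domain
  \<open>range j\<close>.\<close>

definition dense_compact_embedding ::
    "('h1::real_normed_vector \<Rightarrow>\<^sub>L 'h::real_normed_vector) \<Rightarrow> bool" where
  "dense_compact_embedding j \<longleftrightarrow>
     inj j \<and> closure (range j) = UNIV \<and> compact (closure (blinfun_apply j ` cball 0 1))"

definition generates ::
    "('h1::real_normed_vector \<Rightarrow>\<^sub>L 'h::real_normed_vector) \<Rightarrow> ('h1 \<Rightarrow>\<^sub>L 'h) \<Rightarrow>
       (real \<Rightarrow> 'h \<Rightarrow>\<^sub>L 'h) \<Rightarrow> bool" where
  "generates j B S \<longleftrightarrow>
     (\<forall>x y. ((\<lambda>t. (S t x - x) /\<^sub>R t) \<longlongrightarrow> y) (at_right 0) \<longleftrightarrow> (\<exists>v. x = j v \<and> y = B v))"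

definition real_resolvent_set ::
    "('h1::real_normed_vector \<Rightarrow>\<^sub>L 'h::real_normed_vector) \<Rightarrow> ('h1 \<Rightarrow>\<^sub>L 'h) \<Rightarrow> real set" where
  "real_resolvent_set j B =
     {\<mu>. bij (\<lambda>v. \<mu> *\<^sub>R j v - B v) \<and> bounded_linear (\<lambda>y. j (inv (\<lambda>v. \<mu> *\<^sub>R j v - B v) y))}"

text \<open>Paths are only required to be Hoelder continuous on bounded time intervals.\<close>

definition holder_path :: "real \<Rightarrow> (real \<Rightarrow> 'b::metric_space) \<Rightarrow> bool" where
  "holder_path \<rho> f \<longleftrightarrow>
     (\<forall>a b. \<exists>C. \<forall>s\<in>{a..b}. \<forall>t\<in>{a..b}. dist (f s) (f t) \<le> C * \<bar>s - t\<bar> powr \<rho>)"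

definition standing_assumptions ::
    "'w measure \<Rightarrow> (real \<Rightarrow> 'w \<Rightarrow> 'w) \<Rightarrow>
     ('h1::{real_inner, banach, second_countable_topology} \<Rightarrow>\<^sub>L
        'h::{real_inner, banach, second_countable_topology}) \<Rightarrow>
     ('w \<Rightarrow> 'h1 \<Rightarrow>\<^sub>L 'h) \<Rightarrow> real \<Rightarrow> bool" where
  "standing_assumptions M \<theta> j A \<rho> \<longleftrightarrow>
     dense_compact_embedding j \<and>
     (\<forall>v. (\<lambda>\<omega>. A \<omega> v) \<in> borel_measurable M) \<and>
     (\<forall>\<omega>\<in>space M. \<exists>S. analytic_semigroup S \<and> generates j (- A \<omega>) S) \<and>
     0 < \<rho> \<and> \<rho> < 1 \<and>
     (\<forall>\<omega>\<in>space M. holder_path \<rho> (\<lambda>t. A (\<theta> t \<omega>))) \<and>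
     (\<exists>k\<^sub>1 \<in> borel_measurable M.
        (\<forall>\<omega>\<in>space M. 0 \<le> k\<^sub>1 \<omega>) \<and>
        (\<forall>\<omega>\<in>space M. \<exists>\<gamma>>0. holder_path \<gamma> (\<lambda>t. k\<^sub>1 (\<theta> t \<omega>) :: real)) \<and>
        (\<forall>\<omega>\<in>space M. {k\<^sub>1 \<omega>..} \<subseteq> real_resolvent_set j (- A \<omega>)))"


section \<open>Fundamental solutions and mild solutions\<close>

text \<open>Parabolic evolution operator of \<open>du/dt + B(t) u = 0\<close> on the whole line. Only the values
  \<open>V t s\<close> with \<open>s \<le> t\<close> matter.\<close>

definition fundamental_solution ::
    "('h1::real_normed_vector \<Rightarrow>\<^sub>L 'h::real_normed_vector) \<Rightarrow> (real \<Rightarrow> 'h1 \<Rightarrow>\<^sub>L 'h) \<Rightarrow>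
       (real \<Rightarrow> real \<Rightarrow> 'h \<Rightarrow>\<^sub>L 'h) \<Rightarrow> bool" where
  "fundamental_solution j B V \<longleftrightarrow>
     (\<forall>s. V s s = id_blinfun) \<and>
     (\<forall>r s t. r \<le> s \<and> s \<le> t \<longrightarrow> V t s o\<^sub>L V s r = V t r) \<and>
     (\<forall>x. continuous_on {(t, s). s \<le> t} (\<lambda>(t, s). V t s x)) \<and>
     (\<forall>s t x. s < t \<longrightarrow>
        (\<exists>v. V t s x = j v \<and> ((\<lambda>\<tau>. V \<tau> s x) has_vector_derivative - B t v) (at t))) \<and>
     (\<forall>s t v. s < t \<longrightarrow>
        ((\<lambda>\<sigma>. V t \<sigma> (j v)) has_vector_derivative V t s (B s v)) (at s))"

definition generates_linear_rds ::
    "'w measure \<Rightarrow> (real \<Rightarrow> 'w \<Rightarrow> 'w) \<Rightarrow>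
     ('h1::real_normed_vector \<Rightarrow>\<^sub>L 'h::real_normed_vector) \<Rightarrow> ('w \<Rightarrow> 'h1 \<Rightarrow>\<^sub>L 'h) \<Rightarrow>
     (real \<Rightarrow> 'w \<Rightarrow> 'h \<Rightarrow>\<^sub>L 'h) \<Rightarrow> bool" where
  "generates_linear_rds M \<theta> j A U \<longleftrightarrow>
     linear_rds M \<theta> U \<and>
     (\<forall>\<omega>\<in>space M. fundamental_solution j (\<lambda>t. A (\<theta> t \<omega>)) (\<lambda>t s. U (t - s) (\<theta> s \<omega>)))"

text \<open>Besides the Lipschitz constants, also \<open>F (\<theta> s \<omega>) 0\<close> has to be locally integrable in \<open>s\<close> for
  the mild equation to make sense: the Lipschitz bound does not control it. On the circle with
  the rotation flow, \<open>H = \<real>\<close> and \<open>A = 0\<close>, the function \<open>F \<omega> x = 1 / \<bar>\<omega>\<bar>\<close> has Lipschitz constant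
  0, but there is no mild solution on \<open>[0, 1]\<close>.\<close>

definition locally_integrable :: "(real \<Rightarrow> 'b::{banach, second_countable_topology}) \<Rightarrow> bool" where
  "locally_integrable f \<longleftrightarrow> (\<forall>a b. a < b \<longrightarrow> set_integrable lborel {a..b} f)"

text \<open>The integrand has to be Bochner integrable, since the integral of a non-integrable function
  is 0 by convention.\<close>

definition mild_solution ::
    "(real \<Rightarrow> 'w \<Rightarrow> 'w) \<Rightarrow>
     (real \<Rightarrow> 'w \<Rightarrow> 'h::{real_inner, banach, second_countable_topology} \<Rightarrow>\<^sub>L 'h) \<Rightarrow>
     ('w \<Rightarrow> 'h \<Rightarrow> 'h) \<Rightarrow> 'w \<Rightarrow> 'h \<Rightarrow> real \<Rightarrow> (real \<Rightarrow> 'h) \<Rightarrow> bool" where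
  "mild_solution \<theta> U F \<omega> x T u \<longleftrightarrow>
     continuous_on {0..T} u \<and>
     (\<forall>t\<in>{0..T}.
        set_integrable lborel {0..t} (\<lambda>s. U (t - s) (\<theta> s \<omega>) (F (\<theta> s \<omega>) (u s))) \<and>
        u t = U t \<omega> x + (LINT s:{0..t}|lborel. U (t - s) (\<theta> s \<omega>) (F (\<theta> s \<omega>) (u s))))"

end

(* The evolution operator V(t,s) = U(t-s, theta_s omega) is bounded on {0 <= s <= t <= T} by the
   uniform boundedness principle. The weight w = exp(c Lambda), with Lambda the primitive of the
   Lipschitz constant along the orbit, makes the Picard map a contraction by the factor 1/2 in the
   norm sup |u|/w on every [0,T] and also serves as the Gronwall weight. Starting the iteration at 0,
   the solution is the pointwise limit of Picard iterates that are jointly measurable in (t, omega, x);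
   the cocycle property is uniqueness applied to the shifted solution. *)

theory Submission
  imports Defs
begin

text \<open>In the plain supremum norm the Picard map contracts only on short intervals whose length
  depends on \<omega>, and the pieces would have to be glued measurably in \<omega>; a weighted norm
  removes the gluing. Likewise a solution merely shown to exist for each \<omega> carries no
  measurability, so the solution is built as the limit of an explicit sequence that does not mention
  \<open>T\<close>: one function serves every horizon. The evolution operator is only strongly
  continuous, and only for \<open>s \<le> t\<close>. Operator norm bounds therefore come from Baire
  category, and measurability of \<open>V t s (f s)\<close> from a Caratheodory argument. The
  analysis is done for one frozen \<omega>. Randomness returns in two places: joint measurability,
  and the identity that shifting both times of \<open>V\<close> by \<tau> amounts to replacing
  \<omega> by \<open>\<theta> \<tau> \<omega>\<close>.\<close>

section \<open>Uniform boundedness and joint measurability\<close>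

text \<open>Baire category: the closed sets \<open>E n\<close> cover the Banach space, so one of
  them contains a ball, and linearity moves the bound on that ball to the origin.\<close>

lemma uniform_boundedness:
  fixes T :: "'i \<Rightarrow> 'a::banach \<Rightarrow>\<^sub>L 'b::real_normed_vector"
  assumes bdd: "\<And>x. \<exists>C. \<forall>i\<in>I. norm (T i x) \<le> C"
  shows "\<exists>K. \<forall>i\<in>I. norm (T i) \<le> K"
proof -
  define E where "E n = {x. \<forall>i\<in>I. norm (T i x) \<le> real n}" for n
  have closed: "closed (E n)" for n
  proof -
    have "E n = (\<Inter>i\<in>I. {x. norm (T i x) \<le> real n})"
      by (auto simp: E_def)
    then show ?thesis
      by (auto intro!: closed_INT closed_Collect_le continuous_intros)
  qed
  have "(\<Union>n. E n) = UNIV"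
  proof (intro set_eqI iffI UNIV_I)
    fix x
    obtain C where C: "\<forall>i\<in>I. norm (T i x) \<le> C"
      using bdd by blast
    obtain n where "C \<le> real n"
      using real_arch_simple by blast
    with C show "x \<in> (\<Union>n. E n)"
      by (auto simp: E_def intro: order_trans)
  qed
  moreover have "interior (\<Union>n. E n) = {}" if "\<And>n. interior (E n) = {}"
    using Baire_category_alt[of "euclidean :: 'a topology" "range E"] that closed
    by (auto simp: completely_metrizable_space_euclidean)
  ultimately obtain n where "interior (E n) \<noteq> {}"
    by (metis UNIV_not_empty interior_UNIV)
  then obtain z e where e: "0 < e" "cball z e \<subseteq> E n"
    by (metis equals0I mem_interior_cball)
  have "norm (T i) \<le> 2 * real n / e" if i: "i \<in> I" for i
  proof (rule norm_blinfun_bound)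
    fix x
    show "norm (T i x) \<le> 2 * real n / e * norm x"
    proof (cases "x = 0")
      case False
      \<comment> \<open>Scaled to norm \<open>e\<close>, so that \<open>z\<close> and
        \<open>z + y\<close> both lie in the ball; their difference costs the factor 2 in
        \<open>2 * real n / e\<close>.\<close>
      define y where "y = (e / norm x) *\<^sub>R x"
      have "norm y = e"
        using False e by (simp add: y_def)
      then have "z + y \<in> E n" "z \<in> E n"
        using e by (auto simp: dist_norm intro!: subsetD[OF e(2)])
      then have *: "norm (T i (z + y)) \<le> real n" "norm (T i z) \<le> real n"
        using i by (auto simp: E_def)
      have "T i y = T i (z + y) - T i z"
        by (simp add: blinfun.add_right)
      then have "norm (T i y) \<le> 2 * real n"
        using norm_triangle_ineq4[of "T i (z + y)" "T i z"] * by simp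
      moreover have "norm (T i y) = e / norm x * norm (T i x)"
        using e by (simp add: y_def blinfun.scaleR_right)
      ultimately show ?thesis
        using False e by (simp add: field_simps)
    qed simp
  qed (use e in auto)
  then show ?thesis
    by blast
qed

text \<open>Simple functions \<open>s i\<close> converge pointwise to the identity. Since
  \<open>s i\<close> has finite range, \<open>F w (s i x)\<close> is pieced together from finitely
  many measurable sections; continuity in \<open>x\<close> gives the limit.\<close>

lemma caratheodory_measurable:
  fixes F :: "'a \<Rightarrow> 'b::{metric_space, second_countable_topology} \<Rightarrow> 'c::metric_space"
  assumes meas: "\<And>x. (\<lambda>w. F w x) \<in> borel_measurable M"
    and cont: "\<And>w. w \<in> space M \<Longrightarrow> continuous_on UNIV (F w)"
  shows "(\<lambda>(w, x). F w x) \<in> borel_measurable (M \<Otimes>\<^sub>M borel)"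
proof -
  obtain s :: "nat \<Rightarrow> 'b \<Rightarrow> 'b" where s: "\<And>i. simple_function borel (s i)"
      "\<And>x. (\<lambda>i. s i x) \<longlonglongrightarrow> x"
    using borel_measurable_implies_sequence_metric[of "\<lambda>x::'b. x" borel undefined] by auto
  show ?thesis
  proof (rule borel_measurable_LIMSEQ_metric)
    fix i
    have fin: "finite (range (s i))"
      using s(1)[of i] by (auto simp: simple_function_def)
    have "(\<lambda>p. s i (snd p)) \<in> M \<Otimes>\<^sub>M borel \<rightarrow>\<^sub>M count_space (range (s i))"
    proof (rule measurable_compose[OF measurable_snd])
      show "s i \<in> borel \<rightarrow>\<^sub>M count_space (range (s i))"
        using s(1)[of i] fin by (auto simp: measurable_count_space_eq2 simple_function_def)
    qed
    then have "(\<lambda>p. F (fst p) (s i (snd p))) \<in> borel_measurable (M \<Otimes>\<^sub>M borel)"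
      by (rule measurable_compose_countable'[where f="\<lambda>y p. F (fst p) y", rotated])
         (rule countable_finite[OF fin], rule measurable_compose[OF measurable_fst meas])
    then show "(\<lambda>(w, x). F w (s i x)) \<in> borel_measurable (M \<Otimes>\<^sub>M borel)"
      by (simp add: case_prod_beta')
  next
    fix p assume "p \<in> space (M \<Otimes>\<^sub>M (borel :: 'b measure))"
    then obtain w x where p: "p = (w, x)" "w \<in> space M"
      by (cases p) (auto simp: space_pair_measure)
    have "(\<lambda>i. F w (s i x)) \<longlonglongrightarrow> F w x"
      using cont[OF p(2)] s(2)[of x] by (auto intro: continuous_on_tendsto_compose)
    then show "(\<lambda>i. case p of (w, x) \<Rightarrow> F w (s i x)) \<longlonglongrightarrow> (case p of (w, x) \<Rightarrow> F w x)"
      by (simp add: p)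
  qed
qed

section \<open>Set integrals over intervals\<close>

lemma set_integrable_scaleR_continuous:
  fixes f :: "real \<Rightarrow> 'a::{banach, second_countable_topology}"
  assumes f: "set_integrable lborel {a..b} f" and g: "continuous_on {a..b} g"
  shows "set_integrable lborel {a..b} (\<lambda>s. g s *\<^sub>R f s)"
proof -
  obtain B where B: "\<And>s. s \<in> {a..b} \<Longrightarrow> norm (g s) \<le> B"
    using compact_imp_bounded[OF compact_continuous_image[OF g compact_Icc]]
    unfolding bounded_iff by blast
  show ?thesis
  proof (rule set_integrable_bound)
    show "set_integrable lborel {a..b} (\<lambda>s. B *\<^sub>R f s)"
      using f by blast
    have "(\<lambda>s. indicator {a..b} s *\<^sub>R g s) \<in> borel_measurable lborel"
      using borel_measurable_continuous_on_indicator[of "{a..b}" g] g by simp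
    moreover have "(\<lambda>s. indicator {a..b} s *\<^sub>R f s) \<in> borel_measurable lborel"
      using f by (auto simp: set_integrable_def dest: borel_measurable_integrable)
    ultimately have "(\<lambda>s. (indicator {a..b} s *\<^sub>R g s) *\<^sub>R (indicator {a..b} s *\<^sub>R f s)) \<in> borel_measurable lborel"
      by (rule borel_measurable_scaleR)
    also have "(\<lambda>s. (indicator {a..b} s *\<^sub>R g s) *\<^sub>R (indicator {a..b} s *\<^sub>R f s)) =
               (\<lambda>s. indicator {a..b} s *\<^sub>R (g s *\<^sub>R f s))"
      by (auto simp: indicator_def)
    finally show "set_borel_measurable lborel {a..b} (\<lambda>s. g s *\<^sub>R f s)"
      by (simp add: set_borel_measurable_def)
    show "AE s in lborel. s \<in> {a..b} \<longrightarrow> norm (g s *\<^sub>R f s) \<le> norm (B *\<^sub>R f s)"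
      using B by (intro AE_I2 impI) (simp, intro mult_right_mono, force+)
  qed
qed

lemma locally_integrableD:
  assumes "locally_integrable f"
  shows "set_integrable lborel {a..b::real} f"
proof (rule set_integrable_subset)
  \<comment> \<open>\<open>locally_integrable\<close> speaks only of \<open>a < b\<close>; the
    enlarged interval covers degenerate and empty ones too.\<close>
  show "set_integrable lborel {a..max b (a + 1)} f"
    using assms by (simp add: locally_integrable_def)
qed auto

lemma set_integral_Icc_combine:
  fixes f :: "real \<Rightarrow> 'a::{banach, second_countable_topology}"
  assumes "set_integrable lborel {a..c} f" "a \<le> b" "b \<le> c"
  shows "(LINT s:{a..c}|lborel. f s) = (LINT s:{a..b}|lborel. f s) + (LINT s:{b..c}|lborel. f s)"
proof -
  have "{a..c} = {a..b} \<union> {b..c}"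
    using assms by auto
  moreover have "AE s in lborel. \<not> (s \<in> {a..b} \<and> s \<in> {b..c})"
    using AE_lborel_singleton[of b] by eventually_elim auto
  ultimately show ?thesis
    using assms by (auto intro!: set_integral_Un_AE intro: set_integrable_subset)
qed

lemma norm_set_integral_le:
  fixes f :: "'b \<Rightarrow> 'a::{banach, second_countable_topology}"
  assumes "set_integrable M A f" "set_integrable M A g"
    "\<And>s. s \<in> A \<Longrightarrow> norm (f s) \<le> g s"
  shows "norm (LINT s:A|M. f s) \<le> (LINT s:A|M. g s)"
  using assms unfolding set_integrable_def set_lebesgue_integral_def
  by (intro order_trans[OF integral_norm_bound] integral_mono integrable_norm)
     (auto simp: indicator_def)

text \<open>With \<open>\<Lambda>\<close> the primitive of \<open>l\<close>, the weight \<open>w = exp (c \<Lambda>)\<close> works for \<open>c > 4 K\<close>. As \<open>l\<close> is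
  only integrable, there is no chain rule for \<open>w\<close>; instead \<open>c \<integral> l w \<le> 2 (w b - w a)\<close> on intervals
  \<open>[a, b]\<close> so short that \<open>w\<close> at most doubles, and these inequalities add up.\<close>

lemma exponential_weight:
  fixes l :: "real \<Rightarrow> real"
  assumes int: "set_integrable lborel {0..T} l" and nonneg: "\<And>s. 0 \<le> l s" and K: "0 \<le> K"
  obtains w where "continuous_on {0..T} w" "\<And>t. t \<in> {0..T} \<Longrightarrow> 1 \<le> w t"
    "\<And>t. t \<in> {0..T} \<Longrightarrow> K * (LINT s:{0..t}|lborel. l s * w s) \<le> w t / 2"
proof -
  define \<Lambda> where "\<Lambda> t = (LINT s:{0..t}|lborel. l s)" for t
  \<comment> \<open>One factor 2 pays for the doubling of \<open>w\<close> on short intervals, the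
    other for the contraction factor 1/2; the summand 1 keeps \<open>c\<close> positive when
    \<open>K = 0\<close>.\<close>
  define c where "c = 4 * K + 1"
  define w where "w t = exp (c * \<Lambda> t)" for t
  have c: "0 < c"
    using K by (simp add: c_def)
  have int_sub: "set_integrable lborel {a..b} l" if "0 \<le> a" "b \<le> T" for a b
    using int by (rule set_integrable_subset) (use that in auto)
  have diff: "\<Lambda> b - \<Lambda> a = (LINT s:{a..b}|lborel. l s)" if "0 \<le> a" "a \<le> b" "b \<le> T" for a b
    using set_integral_Icc_combine[of 0 b l a] int_sub[of 0 b] that by (simp add: \<Lambda>_def)
  have nonneg_int: "0 \<le> (LINT s:{a..b}|lborel. l s)" for a b
    unfolding set_lebesgue_integral_def using nonneg by (intro Bochner_Integration.integral_nonneg) auto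
  have mono: "\<Lambda> a \<le> \<Lambda> b" if "0 \<le> a" "a \<le> b" "b \<le> T" for a b
    using diff[OF that] nonneg_int[of a b] by simp
  have \<Lambda>_cont: "continuous_on {0..T} \<Lambda>"
  proof -
    have "continuous_on {0..T} (\<lambda>t. integral {0..t} l)"
      using int by (intro indefinite_integral_continuous_1 set_borel_integral_eq_integral)
    then show ?thesis
      by (rule continuous_on_eq) (auto simp: \<Lambda>_def set_borel_integral_eq_integral(2)[OF int_sub])
  qed
  then have w_cont: "continuous_on {0..T} w"
    unfolding w_def by (intro continuous_intros)
  have w_mono: "w a \<le> w b" if "0 \<le> a" "a \<le> b" "b \<le> T" for a b
    using mono[OF that] c by (simp add: w_def)
  have "\<Lambda> 0 = 0"
    by (auto simp: \<Lambda>_def set_integral_at_point)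
  then have w_ge: "1 \<le> w t" if "t \<in> {0..T}" for t
    using mono[of 0 t] that c by (simp add: w_def)
  have lw_int: "set_integrable lborel {a..b} (\<lambda>s. l s * w s)" if "0 \<le> a" "b \<le> T" for a b
    using set_integrable_scaleR_continuous[OF int_sub[OF that], of w] that
      continuous_on_subset[OF w_cont] by (simp add: mult.commute)
  have main: "c * (LINT s:{0..t}|lborel. l s * w s) \<le> 2 * (w t - w 0)" if t: "0 \<le> t" "t \<le> T" for t
  proof -
    \<comment> \<open>The range condition sits inside \<open>P\<close> because the local case of
      \<open>Bolzano\<close> ranges over all short intervals around \<open>x\<close>, including
      those that leave \<open>{0..T}\<close>.\<close>
    define P where "P a b \<longleftrightarrow> (0 \<le> a \<and> a \<le> b \<and> b \<le> T \<longrightarrow>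
      c * (LINT s:{a..b}|lborel. l s * w s) \<le> 2 * (w b - w a))" for a b
    have "P 0 t"
      using \<open>0 \<le> t\<close>
    proof (induction rule: Bolzano)
      case (trans a b d)
      show ?case
        unfolding P_def
      proof safe
        assume *: "0 \<le> a" "a \<le> d" "d \<le> T"
        show "c * (LINT s:{a..d}|lborel. l s * w s) \<le> 2 * (w d - w a)"
          using trans * set_integral_Icc_combine[OF lw_int[of a d], of b]
          by (simp add: P_def distrib_left)
      qed
    next
      case (local x)
      then have x: "x \<in> {0..T}"
        using t by auto
      \<comment> \<open>Both endpoints are within \<open>ln 2 / (2 * c)\<close> of
        \<open>\<Lambda> x\<close>, so \<Lambda> grows by at most \<open>ln 2 / c\<close> between
        them and \<open>w\<close> at most doubles.\<close>
      obtain \<delta> where \<delta>: "\<delta> > 0" "\<And>y. \<lbrakk>y \<in> {0..T}; dist y x < \<delta>\<rbrakk> \<Longrightarrow> dist (\<Lambda> y) (\<Lambda> x) < ln 2 / (2 * c)"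
        using continuous_on_iff[THEN iffD1, rule_format, OF \<Lambda>_cont x, of "ln 2 / (2 * c)"] c by auto
      have "P a b" if ab: "a \<le> x" "x \<le> b" "b - a < \<delta>" for a b
        unfolding P_def
      proof safe
        assume *: "0 \<le> a" "a \<le> b" "b \<le> T"
        have "dist (\<Lambda> a) (\<Lambda> x) < ln 2 / (2 * c)" "dist (\<Lambda> b) (\<Lambda> x) < ln 2 / (2 * c)"
          using \<delta>(2)[of a] \<delta>(2)[of b] ab * by (auto simp: dist_real_def)
        then have "\<Lambda> b - \<Lambda> a \<le> ln 2 / (2 * c) + ln 2 / (2 * c)"
          unfolding dist_real_def by linarith
        also have "\<dots> = ln 2 / c"
          by simp
        finally have "\<Lambda> b - \<Lambda> a \<le> ln 2 / c" .
        then have "c * \<Lambda> b \<le> ln 2 + c * \<Lambda> a"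
          using c by (simp add: field_simps)
        then have "w b \<le> exp (ln 2 + c * \<Lambda> a)"
          unfolding w_def by simp
        then have double: "w b \<le> 2 * w a"
          by (simp add: w_def exp_add)
        have "(LINT s:{a..b}|lborel. l s * w s) \<le> (LINT s:{a..b}|lborel. l s * w b)"
          using * nonneg w_mono lw_int int_sub
          by (intro set_integral_mono) (auto intro!: mult_left_mono)
        also have "\<dots> = (\<Lambda> b - \<Lambda> a) * w b"
          using * by (simp add: diff)
        also have "\<dots> \<le> (\<Lambda> b - \<Lambda> a) * (2 * w a)"
          using mono * double by (intro mult_left_mono) auto
        finally have "c * (LINT s:{a..b}|lborel. l s * w s) \<le> 2 * (c * (\<Lambda> b - \<Lambda> a) * w a)"
          using c by (simp add: mult.assoc mult.left_commute)
        \<comment> \<open>The inequality \<open>1 + y \<le> exp y\<close> turns the increment of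
          \<Lambda> into an increment of \<open>w\<close>.\<close>
        also have "c * (\<Lambda> b - \<Lambda> a) * w a \<le> (exp (c * (\<Lambda> b - \<Lambda> a)) - 1) * w a"
          using exp_ge_add_one_self[of "c * (\<Lambda> b - \<Lambda> a)"]
          by (intro mult_right_mono) (linarith, simp add: w_def)
        also have "\<dots> = w b - w a"
          by (simp add: w_def left_diff_distrib right_diff_distrib flip: exp_add)
        finally show "c * (LINT s:{a..b}|lborel. l s * w s) \<le> 2 * (w b - w a)"
          by simp
      qed
      then show ?case
        using \<delta>(1) by blast
    qed
    then show ?thesis
      using t by (simp add: P_def)
  qed
  have "K * (LINT s:{0..t}|lborel. l s * w s) \<le> w t / 2" if t: "t \<in> {0..T}" for t
  proof -
    define J where "J = (LINT s:{0..t}|lborel. l s * w s)"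
    have "0 \<le> J"
      unfolding J_def set_lebesgue_integral_def using nonneg by (intro Bochner_Integration.integral_nonneg) (auto simp: w_def)
    moreover have "c * J \<le> 2 * (w t - w 0)"
      using main[of t] t by (simp add: J_def)
    ultimately have "4 * (K * J) \<le> 2 * w t"
      using w_ge[of 0] t by (simp add: c_def algebra_simps)
    then show ?thesis
      by (simp add: J_def)
  qed
  then show ?thesis
    using that[of w] w_cont w_ge by blast
qed

text \<open>No iteration: let \<open>m\<close> be the maximum of \<open>g / w\<close>, attained at
  \<open>r\<close>. Inserting \<open>g \<le> m * w\<close> into the hypothesis at \<open>r\<close>
  gives \<open>m * w r \<le> a + m * w r / 2\<close>, hence \<open>m \<le> 2 * a\<close> because
  \<open>1 \<le> w r\<close>.\<close>

lemma weighted_gronwall: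
  fixes l w g :: "real \<Rightarrow> real"
  assumes int: "set_integrable lborel {0..T} l" and nonneg: "\<And>s. 0 \<le> l s" and K: "0 \<le> K"
    and w: "continuous_on {0..T} w" "\<And>t. t \<in> {0..T} \<Longrightarrow> 1 \<le> w t"
      "\<And>t. t \<in> {0..T} \<Longrightarrow> K * (LINT s:{0..t}|lborel. l s * w s) \<le> w t / 2"
    and g: "continuous_on {0..T} g" and a: "0 \<le> a"
    and le: "\<And>t. t \<in> {0..T} \<Longrightarrow> g t \<le> a + K * (LINT s:{0..t}|lborel. l s * g s)"
    and t: "t \<in> {0..T}"
  shows "g t \<le> 2 * a * w t"
proof -
  have "continuous_on {0..T} (\<lambda>t. g t / w t)"
    using g w by (intro continuous_intros) force+
  then obtain r where r: "r \<in> {0..T}" "\<And>s. s \<in> {0..T} \<Longrightarrow> g s / w s \<le> g r / w r"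
    using continuous_attains_sup[of "{0..T}" "\<lambda>t. g t / w t"] t by force
  define m where "m = g r / w r"
  have wpos: "0 < w s" if "s \<in> {0..T}" for s
    using w(2)[OF that] by simp
  have g_le: "g s \<le> m * w s" if "s \<in> {0..T}" for s
    using r(2)[OF that] wpos[OF that] by (simp add: m_def pos_divide_le_eq)
  have sub: "set_integrable lborel {0..r} (\<lambda>s. l s * h s)" if "continuous_on {0..T} h" for h
    using set_integrable_scaleR_continuous[OF int that] r
    by (auto intro: set_integrable_subset simp: mult.commute)
  have "(LINT s:{0..r}|lborel. l s * g s) \<le> (LINT s:{0..r}|lborel. l s * (m * w s))"
    using r g w nonneg by (intro set_integral_mono sub mult_left_mono g_le continuous_intros) auto
  also have "\<dots> = m * (LINT s:{0..r}|lborel. l s * w s)"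
    by (simp add: mult.left_commute)
  finally have "g r \<le> a + m * (K * (LINT s:{0..r}|lborel. l s * w s))"
    using le[OF r(1)] K by (smt (verit, best) mult.left_commute mult_left_mono)
  have "m \<le> 2 * a"
  \<comment> \<open>Multiplying the weight inequality by \<open>m\<close> needs
    \<open>0 \<le> m\<close>; a negative \<open>m\<close> is below \<open>2 * a\<close> anyway,
    since \<open>0 \<le> a\<close>.\<close>
  proof (cases "0 \<le> m")
    case True
    have "m * w r \<le> a + m * (w r / 2)"
    proof -
      have "m * w r = g r"
        using wpos[OF r(1)] by (simp add: m_def)
      then show ?thesis
        using mult_left_mono[OF w(3)[OF r(1)] True] \<open>g r \<le> _\<close> by linarith
    qed
    then have "m * w r \<le> 2 * a"
      by simp
    moreover have "m * 1 \<le> m * w r"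
      using True w(2)[OF r(1)] by (intro mult_left_mono)
    ultimately show ?thesis
      by simp
  qed (use a in auto)
  then have "m * w t \<le> 2 * a * w t"
    using wpos[OF t] by (intro mult_right_mono) auto
  then show ?thesis
    using g_le[OF t] by simp
qed

section \<open>The mild equation along one orbit\<close>

definition duhamel :: "(real \<Rightarrow> real \<Rightarrow> 'h \<Rightarrow>\<^sub>L 'h) \<Rightarrow> (real \<Rightarrow> 'h) \<Rightarrow> real \<Rightarrow>
    'h::{banach, second_countable_topology}" where
  "duhamel V f t = (LINT s:{0..t}|lborel. V t s (f s))"

definition mild_step :: "(real \<Rightarrow> real \<Rightarrow> 'h \<Rightarrow>\<^sub>L 'h) \<Rightarrow> (real \<Rightarrow> 'h \<Rightarrow> 'h) \<Rightarrow> 'h \<Rightarrow> (real \<Rightarrow> 'h) \<Rightarrow> real \<Rightarrow>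
    'h::{banach, second_countable_topology}" where
  "mild_step V G x u t = V t 0 x + duhamel V (\<lambda>s. G s (u s)) t"

definition solves_mild_equation :: "(real \<Rightarrow> real \<Rightarrow> 'h \<Rightarrow>\<^sub>L 'h) \<Rightarrow> (real \<Rightarrow> 'h \<Rightarrow> 'h) \<Rightarrow>
    'h::{banach, second_countable_topology} \<Rightarrow> real \<Rightarrow> (real \<Rightarrow> 'h) \<Rightarrow> bool" where
  "solves_mild_equation V G x T u \<longleftrightarrow> continuous_on {0..T} u \<and>
     (\<forall>t\<in>{0..T}. set_integrable lborel {0..t} (\<lambda>s. V t s (G s (u s))) \<and> u t = mild_step V G x u t)"

text \<open>With the zero function as start, the sum of successive differences telescopes to the
  iterate itself, and the base case of joint measurability is trivial.\<close>

primrec picard :: "(real \<Rightarrow> real \<Rightarrow> 'h \<Rightarrow>\<^sub>L 'h) \<Rightarrow> (real \<Rightarrow> 'h \<Rightarrow> 'h) \<Rightarrow> 'h \<Rightarrow> nat \<Rightarrow> real \<Rightarrow>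
    'h::{banach, second_countable_topology}" where
  "picard V G x 0 = (\<lambda>t. 0)"
| "picard V G x (Suc n) = mild_step V G x (picard V G x n)"

definition picard_limit :: "(real \<Rightarrow> real \<Rightarrow> 'h \<Rightarrow>\<^sub>L 'h) \<Rightarrow> (real \<Rightarrow> 'h \<Rightarrow> 'h) \<Rightarrow> 'h \<Rightarrow> real \<Rightarrow>
    'h::{banach, second_countable_topology}" where
  "picard_limit V G x t = lim (\<lambda>n. picard V G x n t)"

lemma duhamel_0: "duhamel V f 0 = 0"
  unfolding duhamel_def set_lebesgue_integral_def
proof (rule integral_eq_zero_AE)
  show "AE s in lborel. indicator {0..0} s *\<^sub>R V 0 s (f s) = 0"
    using AE_lborel_singleton[of "0::real"] by eventually_elim auto
qed

text \<open>The problem for one fixed \<omega>: the instance is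
  \<open>V t s = U (t - s) (\<theta> s \<omega>)\<close>,
  \<open>G s = F (\<theta> s \<omega>)\<close>,
  \<open>l s = L (\<theta> s \<omega>)\<close>.\<close>

locale semilinear_evolution =
  fixes V :: "real \<Rightarrow> real \<Rightarrow> 'h::{banach, second_countable_topology} \<Rightarrow>\<^sub>L 'h"
    and G :: "real \<Rightarrow> 'h \<Rightarrow> 'h"
    and l :: "real \<Rightarrow> real"
  assumes V_continuous: "\<And>x. continuous_on {(t, s). s \<le> t} (\<lambda>(t, s). V t s x)"
    and V_compose: "\<And>r s t. \<lbrakk>r \<le> s; s \<le> t\<rbrakk> \<Longrightarrow> V t s o\<^sub>L V s r = V t r"
    and G_measurable: "(\<lambda>(s, x). G s x) \<in> borel_measurable (borel \<Otimes>\<^sub>M borel)"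
    and G_lipschitz: "\<And>s. (l s)-lipschitz_on UNIV (G s)"
    and l_integrable: "locally_integrable l"
    and G0_integrable: "locally_integrable (\<lambda>s. G s 0)"
begin

lemma l_nonneg: "0 \<le> l s"
  using G_lipschitz lipschitz_on_nonneg by blast

definition V_bound :: "real \<Rightarrow> real \<Rightarrow> bool" where
  "V_bound T K \<longleftrightarrow> 0 < K \<and> (\<forall>s t. 0 \<le> s \<longrightarrow> s \<le> t \<longrightarrow> t \<le> T \<longrightarrow> norm (V t s) \<le> K)"

lemma V_bound_pos: "V_bound T K \<Longrightarrow> 0 < K"
  by (simp add: V_bound_def)

lemma V_bound_apply:
  assumes "V_bound T K" "0 \<le> s" "s \<le> t" "t \<le> T"
  shows "norm (V t s y) \<le> K * norm y"
  using assms by (auto simp: V_bound_def intro!: norm_blinfun[THEN order_trans] mult_right_mono)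

lemma V_bounded: "\<exists>K. V_bound T K"
proof -
  define D where "D = {(t, s). 0 \<le> s \<and> s \<le> t \<and> t \<le> T}"
  have "D = ({0..T} \<times> {0..T}) \<inter> {p. snd p \<le> fst p}"
    by (auto simp: D_def)
  moreover have "closed {p :: real \<times> real. snd p \<le> fst p}"
    by (intro closed_Collect_le continuous_intros)
  ultimately have D: "compact D"
    by (auto intro!: compact_Int_closed compact_Times)
  have "\<exists>C. \<forall>p\<in>D. norm (V (fst p) (snd p) x) \<le> C" for x
  proof -
    have "continuous_on D (\<lambda>(t, s). V t s x)"
      by (rule continuous_on_subset[OF V_continuous]) (auto simp: D_def)
    then have "bounded ((\<lambda>(t, s). V t s x) ` D)"
      by (intro compact_imp_bounded compact_continuous_image D)
    then show ?thesis
      by (auto simp: bounded_iff case_prod_beta')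
  qed
  from uniform_boundedness[of D "\<lambda>p. V (fst p) (snd p)", OF this]
  obtain K where K: "\<And>p. p \<in> D \<Longrightarrow> norm (V (fst p) (snd p)) \<le> K"
    by auto
  \<comment> \<open>\<open>K\<close> need not be positive, for instance when \<open>D\<close> is
    empty because \<open>T < 0\<close>; the maximum makes it so.\<close>
  have "norm (V t s) \<le> max 1 K" if "0 \<le> s" "s \<le> t" "t \<le> T" for s t
    using K[of "(t, s)"] that by (auto simp: D_def)
  then show ?thesis
    by (intro exI[of _ "max 1 K"]) (auto simp: V_bound_def)
qed

text \<open>Strong continuity holds only for \<open>s \<le> t\<close>. Freezing the second time at
  \<open>t\<close> by \<open>min s t\<close> extends the map continuously to the whole line, where
  the Caratheodory lemma applies.\<close>

lemma V_apply_measurable: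
  assumes [measurable]: "f \<in> borel_measurable borel"
  shows "(\<lambda>s. V t (min s t) (f s)) \<in> borel_measurable borel"
proof -
  have "(\<lambda>(s, y). V t (min s t) y) \<in> borel_measurable (borel \<Otimes>\<^sub>M borel)"
  proof (rule caratheodory_measurable)
    fix y
    have "continuous_on UNIV (\<lambda>s. case (t, min s t) of (t, s) \<Rightarrow> V t s y)"
      by (rule continuous_on_compose2[OF V_continuous]) (auto intro!: continuous_intros)
    then show "(\<lambda>s. V t (min s t) y) \<in> borel_measurable borel"
      by (auto intro: borel_measurable_continuous_onI)
  qed (intro continuous_intros)
  from measurable_compose[OF _ this, of "\<lambda>s. (s, f s)" borel] show ?thesis
    by simp
qed

lemma V_set_measurable:
  assumes f: "set_integrable lborel {0..T} f" and t: "t \<le> T"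
  shows "(\<lambda>s. indicator {0..t} s *\<^sub>R V t s (f s)) \<in> borel_measurable lborel"
proof -
  have "(\<lambda>s. indicator {0..t} s *\<^sub>R f s) \<in> borel_measurable borel"
    using set_integrable_subset[OF f, of "{0..t}"] t
    by (auto simp: set_integrable_def dest: borel_measurable_integrable)
  from V_apply_measurable[OF this, of t]
  have "(\<lambda>s. V t (min s t) (indicator {0..t} s *\<^sub>R f s)) \<in> borel_measurable borel" .
  \<comment> \<open>Off \<open>{0..t}\<close> the operator acts on 0; on it \<open>min s t\<close>
    is \<open>s\<close>.\<close>
  also have "(\<lambda>s. V t (min s t) (indicator {0..t} s *\<^sub>R f s)) = (\<lambda>s. indicator {0..t} s *\<^sub>R V t s (f s))"
    by (auto simp: indicator_def)
  finally show ?thesis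
    by simp
qed

lemma V_integrable:
  assumes f: "set_integrable lborel {0..T} f" and t: "t \<in> {0..T}"
  shows "set_integrable lborel {0..t} (\<lambda>s. V t s (f s))"
proof -
  obtain K where K: "V_bound T K"
    using V_bounded by blast
  show ?thesis
  proof (rule set_integrable_bound)
    show "set_integrable lborel {0..t} (\<lambda>s. K *\<^sub>R f s)"
      using set_integrable_subset[OF f, of "{0..t}"] t by auto
    show "set_borel_measurable lborel {0..t} (\<lambda>s. V t s (f s))"
      using V_set_measurable[OF f] t by (simp add: set_borel_measurable_def)
    show "AE s in lborel. s \<in> {0..t} \<longrightarrow> norm (V t s (f s)) \<le> norm (K *\<^sub>R f s)"
    proof (intro AE_I2 impI)
      fix s assume "s \<in> {0..t}"
      then have "norm (V t s (f s)) \<le> K * norm (f s)"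
        using t by (intro V_bound_apply[OF K]) auto
      then show "norm (V t s (f s)) \<le> norm (K *\<^sub>R f s)"
        using V_bound_pos[OF K] by simp
    qed
  qed
qed

lemma duhamel_bound:
  assumes f: "set_integrable lborel {0..T} f" and g: "set_integrable lborel {0..T} g"
    and le: "\<And>s. s \<in> {0..T} \<Longrightarrow> norm (f s) \<le> g s"
    and K: "V_bound T K" and t: "t \<in> {0..T}"
  shows "norm (duhamel V f t) \<le> K * (LINT s:{0..t}|lborel. g s)"
proof -
  have "norm (duhamel V f t) \<le> (LINT s:{0..t}|lborel. K * g s)"
    unfolding duhamel_def
  proof (rule norm_set_integral_le[OF V_integrable[OF f t]])
    show "set_integrable lborel {0..t} (\<lambda>s. K * g s)"
      using set_integrable_subset[OF g, of "{0..t}"] t by auto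
    fix s assume s: "s \<in> {0..t}"
    then have "norm (V t s (f s)) \<le> K * norm (f s)"
      using t by (intro V_bound_apply[OF K]) auto
    also have "\<dots> \<le> K * g s"
      using V_bound_pos[OF K] le[of s] s t by (intro mult_left_mono) auto
    finally show "norm (V t s (f s)) \<le> K * g s" .
  qed
  then show ?thesis
    by simp
qed

text \<open>Dominated convergence along sequences: both the domain and the operator move with
  \<open>t\<close>, so the moving domain is put into the integrand as an indicator, with majorant
  \<open>K * norm (f s)\<close> on \<open>{0..T}\<close>.\<close>

lemma duhamel_continuous:
  assumes f: "set_integrable lborel {0..T} f"
  shows "continuous_on {0..T} (duhamel V f)"
  unfolding continuous_on_sequentially
proof safe
  fix t :: "nat \<Rightarrow> real" and r
  assume r: "r \<in> {0..T}" and t: "\<forall>n. t n \<in> {0..T}" and lim: "t \<longlonglongrightarrow> r"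
  obtain K where K: "V_bound T K"
    using V_bounded by blast
  have "(\<lambda>n. \<integral>s. indicator {0..t n} s *\<^sub>R V (t n) s (f s) \<partial>lborel) \<longlonglongrightarrow>
        (\<integral>s. indicator {0..r} s *\<^sub>R V r s (f s) \<partial>lborel)"
  proof (rule integral_dominated_convergence)
    show "(\<lambda>s. indicator {0..r} s *\<^sub>R V r s (f s)) \<in> borel_measurable lborel"
         "\<And>n. (\<lambda>s. indicator {0..t n} s *\<^sub>R V (t n) s (f s)) \<in> borel_measurable lborel"
      using V_set_measurable[OF f] r t by auto
    show "integrable lborel (\<lambda>s. K * norm (indicator {0..T} s *\<^sub>R f s))"
      using f by (intro integrable_mult_right integrable_norm) (simp add: set_integrable_def)
    show "AE s in lborel. norm (indicator {0..t n} s *\<^sub>R V (t n) s (f s)) \<le>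
            K * norm (indicator {0..T} s *\<^sub>R f s)" for n
    proof (intro AE_I2)
      fix s
      have "norm (V (t n) s (f s)) \<le> K * norm (f s)" if "s \<in> {0..t n}"
        using t that by (intro V_bound_apply[OF K]) auto
      then show "norm (indicator {0..t n} s *\<^sub>R V (t n) s (f s)) \<le> K * norm (indicator {0..T} s *\<^sub>R f s)"
        using t[rule_format, of n] V_bound_pos[OF K] by (auto simp: indicator_def)
    qed
    show "AE s in lborel. (\<lambda>n. indicator {0..t n} s *\<^sub>R V (t n) s (f s)) \<longlonglongrightarrow>
            indicator {0..r} s *\<^sub>R V r s (f s)"
      \<comment> \<open>At \<open>s = r\<close> the indicators may fail to converge; this single
        point is discarded as a null set.\<close>
      using AE_lborel_singleton[of r]
    proof eventually_elim
      fix s assume "s \<noteq> r"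
      then consider "s < r" | "r < s"
        by linarith
      then show "(\<lambda>n. indicator {0..t n} s *\<^sub>R V (t n) s (f s)) \<longlonglongrightarrow> indicator {0..r} s *\<^sub>R V r s (f s)"
      proof cases
        case 1
        have ev: "eventually (\<lambda>n. s < t n) sequentially"
          using lim 1 by (rule order_tendstoD)
        then have ev': "eventually (\<lambda>n. s \<le> t n) sequentially"
          by eventually_elim simp
        have "(\<lambda>n. case (t n, s) of (t, s) \<Rightarrow> V t s (f s)) \<longlonglongrightarrow> (case (r, s) of (t, s) \<Rightarrow> V t s (f s))"
          using continuous_on_tendsto_compose[OF V_continuous tendsto_Pair[OF lim tendsto_const], of s "f s"]
            1 ev' by simp
        then have "(\<lambda>n. indicator {0..r} s *\<^sub>R V (t n) s (f s)) \<longlonglongrightarrow> indicator {0..r} s *\<^sub>R V r s (f s)"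
          by (intro tendsto_scaleR[OF tendsto_const]) simp
        moreover have "eventually (\<lambda>n. indicator {0..r} s *\<^sub>R V (t n) s (f s) =
            indicator {0..t n} s *\<^sub>R V (t n) s (f s)) sequentially"
          using ev by eventually_elim (use 1 in \<open>auto simp: indicator_def\<close>)
        ultimately show ?thesis
          by (rule Lim_transform_eventually)
      next
        case 2
        have "eventually (\<lambda>n. t n < s) sequentially"
          using lim 2 by (rule order_tendstoD)
        then have "eventually (\<lambda>n. indicator {0..t n} s *\<^sub>R V (t n) s (f s) = 0) sequentially"
          by eventually_elim auto
        then show ?thesis
          using 2 by (simp add: tendsto_eventually)
      qed
    qed
  qed
  then show "(duhamel V f \<circ> t) \<longlonglongrightarrow> duhamel V f r"
    by (simp add: duhamel_def set_lebesgue_integral_def comp_def)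
qed

section \<open>The Picard map: integrability, continuity and the difference estimate\<close>

text \<open>Comparing with the value at 0 gives the majorant
  \<open>norm (G s 0) + l s * norm (u s)\<close>; this is where local integrability of
  \<open>G s 0\<close> enters.\<close>

lemma forcing_integrable:
  assumes u: "continuous_on {0..T} u"
  shows "set_integrable lborel {0..T} (\<lambda>s. G s (u s))"
proof (rule set_integrable_bound)
  have "set_integrable lborel {0..T} (\<lambda>s. norm (G s 0))"
    using locally_integrableD[OF G0_integrable] by (intro set_integrable_norm)
  moreover have "set_integrable lborel {0..T} (\<lambda>s. norm (u s) *\<^sub>R l s)"
    using u by (intro set_integrable_scaleR_continuous locally_integrableD l_integrable continuous_intros)
  ultimately show "set_integrable lborel {0..T} (\<lambda>s. norm (G s 0) + norm (u s) *\<^sub>R l s)"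
    by (rule set_integral_add)
  show "AE s in lborel. s \<in> {0..T} \<longrightarrow> norm (G s (u s)) \<le> norm (norm (G s 0) + norm (u s) *\<^sub>R l s)"
  proof (intro AE_I2 impI)
    fix s
    have "norm (G s (u s) - G s 0) \<le> l s * norm (u s)"
      using lipschitz_on_normD[OF G_lipschitz, of "u s" 0 s] by simp
    then show "norm (G s (u s)) \<le> norm (norm (G s 0) + norm (u s) *\<^sub>R l s)"
      using norm_triangle_sub[of "G s (u s)" "G s 0"] l_nonneg[of s] by (simp add: mult.commute)
  qed
  \<comment> \<open>\<open>u\<close> is controlled only on \<open>{0..T}\<close>; its cut-off is
    Borel on the whole line and can be composed with the jointly measurable
    \<open>G\<close>.\<close>
  define v where "v s = indicator {0..T} s *\<^sub>R u s" for s
  have [measurable]: "v \<in> borel_measurable borel"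
    unfolding v_def using u by (intro borel_measurable_continuous_on_indicator) auto
  have "(\<lambda>s. G s (v s)) \<in> borel_measurable borel"
    using measurable_compose[OF _ G_measurable, of "\<lambda>s. (s, v s)" borel] by simp
  then have "(\<lambda>s. indicator {0..T} s *\<^sub>R G s (v s)) \<in> borel_measurable borel"
    by (intro borel_measurable_scaleR borel_measurable_indicator) auto
  also have "(\<lambda>s. indicator {0..T} s *\<^sub>R G s (v s)) = (\<lambda>s. indicator {0..T} s *\<^sub>R G s (u s))"
    by (auto simp: v_def indicator_def)
  finally show "set_borel_measurable lborel {0..T} (\<lambda>s. G s (u s))"
    by (simp add: set_borel_measurable_def)
qed

lemma mild_step_continuous:
  assumes "continuous_on {0..T} u"
  shows "continuous_on {0..T} (mild_step V G x u)"
proof -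
  have "continuous_on {0..T} (\<lambda>t. case (t, 0) of (t, s) \<Rightarrow> V t s x)"
    by (rule continuous_on_compose2[OF V_continuous]) (auto intro!: continuous_intros)
  then show ?thesis
    using duhamel_continuous[OF forcing_integrable[OF assms]]
    unfolding mild_step_def by (auto intro!: continuous_intros)
qed

text \<open>The majorant \<open>h\<close> is left free for three uses: the difference itself for
  Gronwall, a multiple of the weight for the contraction, and a constant for passing to the
  limit.\<close>

lemma mild_step_diff:
  assumes u: "continuous_on {0..T} u" and v: "continuous_on {0..T} v"
    and h: "continuous_on {0..T} h" "\<And>s. s \<in> {0..T} \<Longrightarrow> norm (u s - v s) \<le> h s"
    and K: "V_bound T K" and t: "t \<in> {0..T}"
  shows "norm (mild_step V G x u t - mild_step V G y v t) \<le>
           K * norm (x - y) + K * (LINT s:{0..t}|lborel. l s * h s)"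
proof -
  let ?d = "\<lambda>s. G s (u s) - G s (v s)"
  have ints: "set_integrable lborel {0..T} (\<lambda>s. G s (u s))" "set_integrable lborel {0..T} (\<lambda>s. G s (v s))"
    using u v by (auto intro: forcing_integrable)
  have "duhamel V (\<lambda>s. G s (u s)) t - duhamel V (\<lambda>s. G s (v s)) t = duhamel V ?d t"
    unfolding duhamel_def using ints[THEN V_integrable, OF t] by (simp add: blinfun.diff_right)
  then have eq: "mild_step V G x u t - mild_step V G y v t = V t 0 (x - y) + duhamel V ?d t"
    by (simp add: mild_step_def blinfun.diff_right algebra_simps)
  have "norm (V t 0 (x - y)) \<le> K * norm (x - y)"
    using t by (intro V_bound_apply[OF K]) auto
  moreover have "norm (duhamel V ?d t) \<le> K * (LINT s:{0..t}|lborel. l s * h s)"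
  proof (rule duhamel_bound[OF _ _ _ K t])
    show "set_integrable lborel {0..T} ?d"
      using ints by auto
    show "set_integrable lborel {0..T} (\<lambda>s. l s * h s)"
      using set_integrable_scaleR_continuous[OF locally_integrableD[OF l_integrable] h(1)]
      by (simp add: mult.commute)
    show "norm (?d s) \<le> l s * h s" if "s \<in> {0..T}" for s
      using lipschitz_on_normD[OF G_lipschitz, of "u s" "v s" s] h(2)[OF that] l_nonneg[of s]
      by (auto intro: order_trans mult_left_mono)
  qed
  ultimately show ?thesis
    unfolding eq by (rule order_trans[OF norm_triangle_ineq add_mono])
qed

section \<open>Uniqueness and convergence of the iteration\<close>

lemma ex_weight:
  "\<exists>K w. V_bound T K \<and> continuous_on {0..T} w \<and> (\<forall>t\<in>{0..T}. 1 \<le> w t) \<and>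
     (\<forall>t\<in>{0..T}. K * (LINT s:{0..t}|lborel. l s * w s) \<le> w t / 2)"
proof -
  obtain K where K: "V_bound T K"
    using V_bounded by blast
  from exponential_weight[OF locally_integrableD[OF l_integrable] l_nonneg, of K T]
  show ?thesis
    using K V_bound_pos[OF K] by (metis less_imp_le)
qed

text \<open>Gronwall with \<open>a = K * norm (x - y)\<close>. As \<open>C\<close> is chosen before
  the data and the solutions, the case \<open>x = y\<close> is uniqueness and the general case is
  Lipschitz dependence on the initial value.\<close>

lemma solutions_dist:
  assumes t: "t \<in> {0..T}"
  shows "\<exists>C\<ge>0. \<forall>x y u v. solves_mild_equation V G x T u \<longrightarrow> solves_mild_equation V G y T v \<longrightarrow>
           norm (u t - v t) \<le> C * norm (x - y)"
proof -
  obtain K w where K: "V_bound T K"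
    and w: "continuous_on {0..T} w" "\<And>t. t \<in> {0..T} \<Longrightarrow> 1 \<le> w t"
      "\<And>t. t \<in> {0..T} \<Longrightarrow> K * (LINT s:{0..t}|lborel. l s * w s) \<le> w t / 2"
    using ex_weight[of T] by blast
  have "norm (u t - v t) \<le> 2 * K * w t * norm (x - y)"
    if sol: "solves_mild_equation V G x T u" "solves_mild_equation V G y T v" for x y u v
  proof -
    have cont: "continuous_on {0..T} u" "continuous_on {0..T} v"
      using sol by (auto simp: solves_mild_equation_def)
    then have cont_diff: "continuous_on {0..T} (\<lambda>t. norm (u t - v t))"
      by (intro continuous_intros)
    have "norm (u t - v t) \<le> 2 * (K * norm (x - y)) * w t"
    proof (rule weighted_gronwall[OF locally_integrableD[OF l_integrable] l_nonneg _ w cont_diff _ _ t])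
      show "norm (u r - v r) \<le> K * norm (x - y) + K * (LINT s:{0..r}|lborel. l s * norm (u s - v s))"
        if r: "r \<in> {0..T}" for r
        using mild_step_diff[OF cont cont_diff order_refl K r, of x y] sol r
        by (simp add: solves_mild_equation_def)
    qed (use V_bound_pos[OF K] in auto)
    then show ?thesis
      by (simp add: mult_ac)
  qed
  then show ?thesis
    using V_bound_pos[OF K] w(2)[OF t] by (intro exI[of _ "2 * K * w t"]) auto
qed

lemma picard_continuous: "continuous_on {0..T} (picard V G x n)"
  by (induction n) (auto intro: mild_step_continuous)

text \<open>One step sends a majorant \<open>c * w\<close> of a difference to
  \<open>c * w / 2\<close>, the initial values cancelling. The differences are thus dominated by a
  geometric series times a bound \<open>W\<close> of the weight.\<close>

lemma picard_uniform_limit: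
  "uniform_limit {0..T} (picard V G x) (picard_limit V G x) sequentially"
proof -
  obtain K w where K: "V_bound T K"
    and w: "continuous_on {0..T} w" "\<And>t. t \<in> {0..T} \<Longrightarrow> 1 \<le> w t"
      "\<And>t. t \<in> {0..T} \<Longrightarrow> K * (LINT s:{0..t}|lborel. l s * w s) \<le> w t / 2"
    using ex_weight[of T] by blast
  define d where "d n t = picard V G x (Suc n) t - picard V G x n t" for n t
  obtain B where B: "\<And>t. t \<in> {0..T} \<Longrightarrow> norm (picard V G x 1 t) \<le> B"
    using compact_imp_bounded[OF compact_continuous_image[OF picard_continuous compact_Icc]]
    unfolding bounded_iff by blast
  obtain W where W: "\<And>t. t \<in> {0..T} \<Longrightarrow> norm (w t) \<le> W"
    using compact_imp_bounded[OF compact_continuous_image[OF w(1) compact_Icc]]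
    unfolding bounded_iff by blast
  have d_le: "norm (d n t) \<le> \<bar>B\<bar> * (1 / 2) ^ n * w t" if "t \<in> {0..T}" for n t
    using that
  proof (induction n arbitrary: t)
    case 0
    have "norm (d 0 t) \<le> \<bar>B\<bar> * 1"
      using B[OF 0] by (simp add: d_def)
    also have "\<dots> \<le> \<bar>B\<bar> * w t"
      using w(2)[OF 0] by (intro mult_left_mono) auto
    finally show ?case
      by simp
  next
    case (Suc n)
    let ?c = "\<bar>B\<bar> * (1 / 2) ^ n"
    have d_Suc: "d (Suc n) t = mild_step V G x (picard V G x (Suc n)) t - mild_step V G x (picard V G x n) t"
      by (simp add: d_def)
    have "norm (d (Suc n) t) \<le> K * norm (x - x) + K * (LINT s:{0..t}|lborel. l s * (?c * w s))"
      unfolding d_Suc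
    proof (rule mild_step_diff[OF picard_continuous picard_continuous _ _ K \<open>t \<in> {0..T}\<close>])
      show "continuous_on {0..T} (\<lambda>s. ?c * w s)"
        using w(1) by (intro continuous_intros)
      show "norm (picard V G x (Suc n) s - picard V G x n s) \<le> ?c * w s" if "s \<in> {0..T}" for s
        using Suc.IH[OF that] by (simp add: d_def)
    qed
    also have "\<dots> = ?c * (K * (LINT s:{0..t}|lborel. l s * w s))"
      by (simp add: mult.left_commute[of _ ?c])
    also have "\<dots> \<le> ?c * (w t / 2)"
      by (intro mult_left_mono w(3) Suc.prems) auto
    finally show ?case
      by simp
  qed
  have sum_d: "(\<Sum>i<n. d i t) = picard V G x n t" for n t
    by (induction n) (auto simp: d_def)
  have "uniform_limit {0..T} (\<lambda>n t. \<Sum>i<n. d i t) (\<lambda>t. \<Sum>i. d i t) sequentially"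
  proof (rule Weierstrass_m_test)
    show "norm (d n t) \<le> \<bar>B\<bar> * (1 / 2) ^ n * W" if "t \<in> {0..T}" for n t
      using d_le[OF that, of n] W[OF that]
      by (elim order_trans) (auto intro!: mult_left_mono)
    show "summable (\<lambda>n. \<bar>B\<bar> * (1 / 2) ^ n * W)"
      by (intro summable_mult summable_mult2 summable_geometric) auto
  qed
  then have *: "uniform_limit {0..T} (picard V G x) (\<lambda>t. \<Sum>i. d i t) sequentially"
    by (simp add: sum_d)
  \<comment> \<open>The pointwise \<open>lim\<close> agrees with the series on every
    \<open>{0..T}\<close>, so the limit does not depend on the horizon.\<close>
  then have "picard_limit V G x t = (\<Sum>i. d i t)" if "t \<in> {0..T}" for t
    unfolding picard_limit_def using that by (intro limI tendsto_uniform_limitI) auto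
  with * show ?thesis
    by (subst uniform_limit_cong'[where g="picard V G x" and i="\<lambda>t. \<Sum>i. d i t"]) auto
qed

lemma picard_limit_continuous: "continuous_on {0..T} (picard_limit V G x)"
  using picard_continuous
  by (intro uniform_limit_theorem[OF _ picard_uniform_limit]) (auto intro: always_eventually)

lemma picard_tendsto: "0 \<le> t \<Longrightarrow> (\<lambda>n. picard V G x n t) \<longlonglongrightarrow> picard_limit V G x t"
  using tendsto_uniform_limitI[OF picard_uniform_limit[where T=t]] by simp

text \<open>Let \<open>n\<close> tend to infinity in the recursion: uniform closeness \<delta> on
  \<open>{0..t}\<close> costs at most \<open>K * J * \<delta>\<close> after one step.\<close>

lemma picard_limit_fixpoint:
  assumes "0 \<le> t"
  shows "picard_limit V G x t = mild_step V G x (picard_limit V G x) t"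
proof -
  obtain K where K: "V_bound t K"
    using V_bounded by blast
  define J where "J = (LINT s:{0..t}|lborel. l s)"
  have "0 \<le> J"
    unfolding J_def set_lebesgue_integral_def using l_nonneg by (intro Bochner_Integration.integral_nonneg) auto
  have "(\<lambda>n. picard V G x (Suc n) t) \<longlonglongrightarrow> mild_step V G x (picard_limit V G x) t"
    unfolding tendsto_iff
  proof safe
    fix e :: real assume "0 < e"
    \<comment> \<open>The summand 1 avoids division by 0 and makes
      \<open>K * J * \<delta> < e\<close> strict.\<close>
    define \<delta> where "\<delta> = e / (K * J + 1)"
    have "0 \<le> K * J"
      using V_bound_pos[OF K] \<open>0 \<le> J\<close> by simp
    then have "0 < \<delta>" "K * J * \<delta> < e"
      unfolding \<delta>_def using \<open>0 < e\<close> by (simp, simp add: pos_divide_less_eq distrib_left mult.commute)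
    have "eventually (\<lambda>n. \<forall>s\<in>{0..t}. dist (picard V G x n s) (picard_limit V G x s) < \<delta>) sequentially"
      using picard_uniform_limit[where T=t] \<open>0 < \<delta>\<close> by (rule uniform_limitD)
    then show "eventually (\<lambda>n. dist (picard V G x (Suc n) t) (mild_step V G x (picard_limit V G x) t) < e) sequentially"
    proof eventually_elim
      case (elim n)
      have "norm (mild_step V G x (picard V G x n) t - mild_step V G x (picard_limit V G x) t) \<le>
          K * norm (x - x) + K * (LINT s:{0..t}|lborel. l s * \<delta>)"
        using elim assms
        by (intro mild_step_diff[OF picard_continuous picard_limit_continuous _ _ K])
           (auto simp: dist_norm less_imp_le)
      also have "\<dots> = K * J * \<delta>"
        by (simp add: J_def)
      finally show ?case
        using \<open>K * J * \<delta> < e\<close> by (simp add: dist_norm)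
    qed
  qed
  then show ?thesis
    using LIMSEQ_Suc[OF picard_tendsto[OF assms, of x]] LIMSEQ_unique by blast
qed

lemma picard_limit_solves: "solves_mild_equation V G x T (picard_limit V G x)"
  unfolding solves_mild_equation_def
  using picard_limit_continuous[of T x] picard_limit_fixpoint[of _ x]
    V_integrable[OF forcing_integrable[OF picard_limit_continuous[of T x]]] by simp

lemma solution_unique:
  assumes "solves_mild_equation V G x T u" "t \<in> {0..T}"
  shows "u t = picard_limit V G x t"
proof -
  obtain C where "norm (u t - picard_limit V G x t) \<le> C * norm (x - x)"
    using solutions_dist[OF assms(2)] assms(1) picard_limit_solves by blast
  then show ?thesis
    by simp
qed

lemma picard_limit_lipschitz:
  assumes "0 \<le> t"
  shows "\<exists>C. C-lipschitz_on UNIV (\<lambda>x. picard_limit V G x t)"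
proof -
  obtain C where "0 \<le> C" "\<And>x y. norm (picard_limit V G x t - picard_limit V G y t) \<le> C * norm (x - y)"
    using solutions_dist[of t t] assms picard_limit_solves by (metis atLeastAtMost_iff order_refl)
  then have "C-lipschitz_on UNIV (\<lambda>x. picard_limit V G x t)"
    by (intro lipschitz_onI) (auto simp: dist_norm)
  then show ?thesis
    by blast
qed

text \<open>Split the integral at \<tau>. By the composition law the part up to \<tau>, together
  with the initial term, is \<open>V (t + \<tau>) \<tau>\<close> applied to \<open>u \<tau>\<close>;
  the rest is a translated Duhamel integral.\<close>

lemma solution_shift:
  assumes sol: "solves_mild_equation V G x (T + \<tau>) u" and \<tau>: "0 \<le> \<tau>"
  shows "solves_mild_equation (\<lambda>t s. V (t + \<tau>) (s + \<tau>)) (\<lambda>s. G (s + \<tau>)) (u \<tau>) T (\<lambda>t. u (t + \<tau>))"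
  unfolding solves_mild_equation_def
proof (intro conjI ballI)
  have u: "continuous_on {0..T + \<tau>} u"
    using sol by (simp add: solves_mild_equation_def)
  then show "continuous_on {0..T} (\<lambda>t. u (t + \<tau>))"
    using \<tau> by (rule_tac continuous_on_compose2) (auto intro!: continuous_intros)
  fix t assume t: "t \<in> {0..T}"
  define h where "h s = V (t + \<tau>) s (G s (u s))" for s
  have h: "set_integrable lborel {0..t + \<tau>} h" and
    u_eq: "u (t + \<tau>) = V (t + \<tau>) 0 x + (LINT s:{0..t + \<tau>}|lborel. h s)"
    using sol[unfolded solves_mild_equation_def, THEN conjunct2, rule_format, of "t + \<tau>"] t \<tau>
    by (simp_all add: mild_step_def duhamel_def h_def[abs_def])
  have f: "set_integrable lborel {0..\<tau>} (\<lambda>s. V \<tau> s (G s (u s)))" and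
    u\<tau>: "u \<tau> = V \<tau> 0 x + (LINT s:{0..\<tau>}|lborel. V \<tau> s (G s (u s)))"
    using sol t \<tau> by (auto simp: solves_mild_equation_def mild_step_def duhamel_def)
  have V_V: "V (t + \<tau>) \<tau> (V \<tau> s y) = V (t + \<tau>) s y" if "s \<le> \<tau>" for s y
    using V_compose[of s \<tau> "t + \<tau>"] that t by (auto dest: arg_cong[where f="\<lambda>B. blinfun_apply B y"])
  \<comment> \<open>The factor \<open>1 *\<close> matches the affine substitution rule for
    \<open>lborel\<close>.\<close>
  have ind: "indicator {\<tau>..t + \<tau>} (\<tau> + 1 * s) = (indicator {0..t} s :: real)" for s
    by (auto simp: indicator_def)
  have "set_integrable lborel {\<tau>..t + \<tau>} h"
    using h \<tau> by (rule_tac set_integrable_subset) auto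
  then have "integrable lborel (\<lambda>s. indicator {\<tau>..t + \<tau>} (\<tau> + 1 * s) *\<^sub>R h (\<tau> + 1 * s))"
    unfolding set_integrable_def by (intro lborel_integrable_real_affine) auto
  then show "set_integrable lborel {0..t} (\<lambda>s. V (t + \<tau>) (s + \<tau>) (G (s + \<tau>) (u (s + \<tau>))))"
    unfolding ind by (simp add: set_integrable_def h_def add.commute)
  have "(LINT s:{\<tau>..t + \<tau>}|lborel. h s) = (LINT s:{0..t}|lborel. h (s + \<tau>))"
    unfolding set_lebesgue_integral_def
    by (subst lborel_integral_real_affine[where c=1 and t=\<tau>]) (simp_all only: ind, simp_all add: add.commute)
  moreover have "(LINT s:{0..\<tau>}|lborel. h s) = V (t + \<tau>) \<tau> (LINT s:{0..\<tau>}|lborel. V \<tau> s (G s (u s)))"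
  proof -
    \<comment> \<open>A bounded operator commutes with the Bochner integral.\<close>
    have "V (t + \<tau>) \<tau> (LINT s:{0..\<tau>}|lborel. V \<tau> s (G s (u s))) =
        (LINT s:{0..\<tau>}|lborel. V (t + \<tau>) \<tau> (V \<tau> s (G s (u s))))"
      using integral_bounded_linear[OF blinfun.bounded_linear_right f[unfolded set_integrable_def], of "V (t + \<tau>) \<tau>"]
      by (simp add: set_lebesgue_integral_def blinfun.scaleR_right)
    also have "\<dots> = (LINT s:{0..\<tau>}|lborel. h s)"
      by (intro set_lebesgue_integral_cong) (auto simp: h_def V_V)
    finally show ?thesis ..
  qed
  ultimately have "u (t + \<tau>) = V (t + \<tau>) \<tau> (u \<tau>) + (LINT s:{0..t}|lborel. h (s + \<tau>))"
    using set_integral_Icc_combine[OF h, of \<tau>] u_eq u\<tau> t \<tau> by (simp add: V_V blinfun.add_right)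
  then show "u (t + \<tau>) = mild_step (\<lambda>t s. V (t + \<tau>) (s + \<tau>)) (\<lambda>s. G (s + \<tau>)) (u \<tau>) (\<lambda>t. u (t + \<tau>)) t"
    by (simp add: mild_step_def duhamel_def h_def)
qed

end

section \<open>Joint measurability of the iterates\<close>

text \<open>Induction on \<open>n\<close>. With the domain \<open>{0..t}\<close> moved into the
  integrand as an indicator, the Duhamel term is an integral over the fixed space
  \<open>lborel\<close> depending measurably on the parameters
  \<open>(t, \<omega>, x)\<close>.\<close>

lemma picard_measurable:
  fixes M :: "'w measure" and F :: "'w \<Rightarrow> 'h \<Rightarrow> 'h::{banach, second_countable_topology}"
  assumes flow: "(\<lambda>(t, \<omega>). \<theta> t \<omega>) \<in> borel \<Otimes>\<^sub>M M \<rightarrow>\<^sub>M M"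
    and U: "(\<lambda>(t, \<omega>, x). blinfun_apply (U t \<omega>) x) \<in> restrict_space borel {0..} \<Otimes>\<^sub>M (M \<Otimes>\<^sub>M borel) \<rightarrow>\<^sub>M borel"
    and F: "(\<lambda>(\<omega>, x). F \<omega> x) \<in> borel_measurable (M \<Otimes>\<^sub>M borel)"
  shows "(\<lambda>(t, \<omega>, x). picard (\<lambda>t s. U (t - s) (\<theta> s \<omega>)) (\<lambda>s. F (\<theta> s \<omega>)) x n t)
           \<in> restrict_space borel {0::real..} \<Otimes>\<^sub>M (M \<Otimes>\<^sub>M borel) \<rightarrow>\<^sub>M borel"
proof (induction n)
  case 0
  then show ?case
    by (simp add: case_prod_beta')
next
  case (Suc n)
  let ?R = "restrict_space borel {0::real..}"
  let ?N = "?R \<Otimes>\<^sub>M (M \<Otimes>\<^sub>M (borel :: 'h measure))"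
  define P where "P = (\<lambda>(t, \<omega>, x). picard (\<lambda>t s. U (t - s) (\<theta> s \<omega>)) (\<lambda>s. F (\<theta> s \<omega>)) x n t)"
  have P: "P \<in> ?N \<rightarrow>\<^sub>M borel"
    using Suc by (simp add: P_def)
  \<comment> \<open>\<open>U\<close> and the previous iterate are measurable only for nonnegative
    times; clamping makes them total in time.\<close>
  have pos: "(\<lambda>s. max 0 s) \<in> borel \<rightarrow>\<^sub>M ?R"
    by (rule measurable_restrict_space2) auto
  have fst: "fst \<in> ?N \<rightarrow>\<^sub>M borel"
    by (rule measurable_compose[OF measurable_fst]) (rule measurable_restrict_space1, simp)
  have flow': "(\<lambda>y. \<theta> (s y) (w y)) \<in> K \<rightarrow>\<^sub>M M"
    if "s \<in> K \<rightarrow>\<^sub>M borel" "w \<in> K \<rightarrow>\<^sub>M M" for K :: "'b measure" and s w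
    using measurable_compose[OF measurable_Pair[OF that] flow] by simp
  have U': "(\<lambda>y. U (max 0 (s y)) (w y) (x y)) \<in> borel_measurable K"
    if "s \<in> K \<rightarrow>\<^sub>M borel" "w \<in> K \<rightarrow>\<^sub>M M" "x \<in> K \<rightarrow>\<^sub>M borel" for K :: "'b measure" and s w x
    using measurable_compose[OF measurable_Pair[OF measurable_compose[OF that(1) pos] measurable_Pair[OF that(2,3)]] U]
    by simp
  define g where "g p s = indicator {0..fst p} s *\<^sub>R U (max 0 (fst p - s)) (\<theta> s (fst (snd p)))
      (F (\<theta> s (fst (snd p))) (P (max 0 s, fst (snd p), snd (snd p))))" for p s
  let ?K = "?N \<Otimes>\<^sub>M lborel"
  have [measurable]: "(\<lambda>y. fst (fst y)) \<in> ?K \<rightarrow>\<^sub>M borel"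
    by (rule measurable_compose[OF measurable_fst fst])
  have [measurable]: "snd \<in> ?K \<rightarrow>\<^sub>M borel"
    by simp
  have w: "(\<lambda>y. fst (snd (fst y))) \<in> ?K \<rightarrow>\<^sub>M M" and x: "(\<lambda>y. snd (snd (fst y))) \<in> ?K \<rightarrow>\<^sub>M borel"
    by (rule measurable_compose[OF measurable_fst], simp)+
  have "(\<lambda>y. P (max 0 (snd y), fst (snd (fst y)), snd (snd (fst y)))) \<in> borel_measurable ?K"
    by (rule measurable_compose[OF _ P]) (intro measurable_Pair w x measurable_compose[OF _ pos], simp)
  with flow'[OF _ w, of snd]
  have "(\<lambda>y. F (\<theta> (snd y) (fst (snd (fst y)))) (P (max 0 (snd y), fst (snd (fst y)), snd (snd (fst y)))))
      \<in> borel_measurable ?K"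
    using measurable_compose[OF measurable_Pair F] by simp
  with flow'[OF _ w, of snd]
  have "(\<lambda>y. U (max 0 (fst (fst y) - snd y)) (\<theta> (snd y) (fst (snd (fst y))))
      (F (\<theta> (snd y) (fst (snd (fst y)))) (P (max 0 (snd y), fst (snd (fst y)), snd (snd (fst y))))))
      \<in> borel_measurable ?K"
    by (intro U') auto
  moreover have "(\<lambda>y. indicator {0..fst (fst y)} (snd y) :: real) \<in> borel_measurable ?K"
    unfolding indicator_def atLeastAtMost_iff by measurable
  ultimately have "(\<lambda>(p, s). g p s) \<in> borel_measurable ?K"
    unfolding g_def case_prod_beta' by (intro borel_measurable_scaleR)
  then have "(\<lambda>p. \<integral>s. g p s \<partial>lborel) \<in> borel_measurable ?N"
    by (rule lborel.borel_measurable_lebesgue_integral)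
  moreover have "(\<lambda>p. U (max 0 (fst p - 0)) (\<theta> 0 (fst (snd p))) (snd (snd p))) \<in> borel_measurable ?N"
    using fst by (intro U' flow') auto
  ultimately have "(\<lambda>p. U (max 0 (fst p - 0)) (\<theta> 0 (fst (snd p))) (snd (snd p)) + (\<integral>s. g p s \<partial>lborel))
      \<in> borel_measurable ?N"
    by (rule borel_measurable_add[rotated])
  then show ?case
  proof (rule measurable_cong[THEN iffD1, rotated])
    fix p assume "p \<in> space ?N"
    then obtain t \<omega> x where p: "p = (t, \<omega>, x)" "0 \<le> t"
      by (cases p) (auto simp: space_pair_measure space_restrict_space)
    \<comment> \<open>On \<open>{0..t}\<close> both \<open>s\<close> and \<open>t - s\<close> are
      nonnegative, so the clamps disappear.\<close>
    have "(\<integral>s. g p s \<partial>lborel) =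
        (LINT s:{0..t}|lborel. U (t - s) (\<theta> s \<omega>) (F (\<theta> s \<omega>) (P (s, \<omega>, x))))"
      unfolding set_lebesgue_integral_def
      by (intro Bochner_Integration.integral_cong) (auto simp: g_def p indicator_def max_def)
    then show "U (max 0 (fst p - 0)) (\<theta> 0 (fst (snd p))) (snd (snd p)) + (\<integral>s. g p s \<partial>lborel) =
        (case p of (t, \<omega>, x) \<Rightarrow> picard (\<lambda>t s. U (t - s) (\<theta> s \<omega>)) (\<lambda>s. F (\<theta> s \<omega>)) x (Suc n) t)"
      using p by (simp add: mild_step_def duhamel_def P_def)
  qed
qed

section \<open>From single orbits to the random dynamical system\<close>

theorem theorem3p5:
  fixes M :: "'w measure"
    and \<theta> :: "real \<Rightarrow> 'w \<Rightarrow> 'w"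
    and j :: "'h1::{real_inner, banach, second_countable_topology} \<Rightarrow>\<^sub>L
              'h::{real_inner, banach, second_countable_topology}"
    and A :: "'w \<Rightarrow> 'h1 \<Rightarrow>\<^sub>L 'h"
    and \<rho> :: real
    and U :: "real \<Rightarrow> 'w \<Rightarrow> 'h \<Rightarrow>\<^sub>L 'h"
    and F :: "'w \<Rightarrow> 'h \<Rightarrow> 'h"
    and L :: "'w \<Rightarrow> real"
  assumes "metric_dynamical_system M \<theta>"
    and "standing_assumptions M \<theta> j A \<rho>"
    and "generates_linear_rds M \<theta> j A U"
    and "\<And>x. (\<lambda>\<omega>. F \<omega> x) \<in> borel_measurable M"
    and "\<And>\<omega>. \<omega> \<in> space M \<Longrightarrow> (L \<omega>)-lipschitz_on UNIV (F \<omega>)"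
    and "\<And>\<omega>. \<omega> \<in> space M \<Longrightarrow> locally_integrable (\<lambda>s. L (\<theta> s \<omega>))"
    and "\<And>\<omega>. \<omega> \<in> space M \<Longrightarrow> locally_integrable (\<lambda>s. F (\<theta> s \<omega>) 0)"
  shows "\<exists>\<phi>. continuous_rds M \<theta> \<phi> \<and>
           (\<forall>\<omega>\<in>space M. \<forall>x. \<forall>T>0.
              mild_solution \<theta> U F \<omega> x T (\<lambda>t. \<phi> t \<omega> x) \<and>
              (\<forall>u. mild_solution \<theta> U F \<omega> x T u \<longrightarrow> (\<forall>t\<in>{0..T}. u t = \<phi> t \<omega> x)))"
proof -
  interpret metric_dynamical_system M \<theta>
    by fact
  have U_meas: "(\<lambda>(t, \<omega>, x). U t \<omega> x) \<in> restrict_space borel {0..} \<Otimes>\<^sub>M (M \<Otimes>\<^sub>M borel) \<rightarrow>\<^sub>M borel"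
    and U_0: "\<And>\<omega> x. \<omega> \<in> space M \<Longrightarrow> U 0 \<omega> x = x"
    using assms(3) by (auto simp: generates_linear_rds_def linear_rds_def continuous_rds_def)
  have fund: "fundamental_solution j (\<lambda>t. A (\<theta> t \<omega>)) (\<lambda>t s. U (t - s) (\<theta> s \<omega>))" if "\<omega> \<in> space M" for \<omega>
    using assms(3) that by (auto simp: generates_linear_rds_def)
  have F_meas: "(\<lambda>(\<omega>, x). F \<omega> x) \<in> borel_measurable (M \<Otimes>\<^sub>M borel)"
    using assms(4,5) by (intro caratheodory_measurable) (auto intro: lipschitz_on_continuous_on)
  have flow_in: "\<theta> s \<omega> \<in> space M" if "\<omega> \<in> space M" for s \<omega>
    using measurable_space[OF measurable_flow, of "(s, \<omega>)"] that by (simp add: space_pair_measure)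
  define V where "V \<omega> t s = U (t - s) (\<theta> s \<omega>)" for \<omega> t s
  define G where "G \<omega> s = F (\<theta> s \<omega>)" for \<omega> s
  have evo: "semilinear_evolution (V \<omega>) (G \<omega>) (\<lambda>s. L (\<theta> s \<omega>))" if \<omega>: "\<omega> \<in> space M" for \<omega>
  proof
    show "continuous_on {(t, s). s \<le> t} (\<lambda>(t, s). V \<omega> t s x)" for x
      using fund[OF \<omega>] by (simp add: fundamental_solution_def V_def)
    show "V \<omega> t s o\<^sub>L V \<omega> s r = V \<omega> t r" if "r \<le> s" "s \<le> t" for r s t
      using fund[OF \<omega>] that by (simp add: fundamental_solution_def V_def)
    have "(\<lambda>s. \<theta> s \<omega>) \<in> borel \<rightarrow>\<^sub>M M"
      using measurable_compose[OF measurable_Pair[OF measurable_ident measurable_const[OF \<omega>]] measurable_flow]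
      by simp
    then have "(\<lambda>p. (\<theta> (fst p) \<omega>, snd p)) \<in> borel \<Otimes>\<^sub>M borel \<rightarrow>\<^sub>M M \<Otimes>\<^sub>M (borel :: 'h measure)"
      by (intro measurable_Pair measurable_snd) (rule measurable_compose[OF measurable_fst])
    from measurable_compose[OF this F_meas]
    show "(\<lambda>(s, x). G \<omega> s x) \<in> borel_measurable (borel \<Otimes>\<^sub>M borel)"
      by (simp add: G_def case_prod_beta')
    show "(L (\<theta> s \<omega>))-lipschitz_on UNIV (G \<omega> s)" for s
      using assms(5)[OF flow_in[OF \<omega>]] by (simp add: G_def)
    show "locally_integrable (\<lambda>s. L (\<theta> s \<omega>))" "locally_integrable (\<lambda>s. G \<omega> s 0)"
      using assms(6,7)[OF \<omega>] by (simp_all add: G_def)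
  qed
  \<comment> \<open>The two forms differ only in the initial term, \<open>U t \<omega> x\<close>
    against \<open>U (t - 0) (\<theta> 0 \<omega>) x\<close>.\<close>
  have mild_iff: "mild_solution \<theta> U F \<omega> x T u \<longleftrightarrow> solves_mild_equation (V \<omega>) (G \<omega>) x T u"
    if "\<omega> \<in> space M" for \<omega> x T u
    using flow_zero[OF that]
    by (simp add: mild_solution_def solves_mild_equation_def mild_step_def duhamel_def V_def G_def)
  define \<phi> where "\<phi> t \<omega> x = picard_limit (V \<omega>) (G \<omega>) x t" for t \<omega> x
  have meas: "(\<lambda>(t, \<omega>, x). \<phi> t \<omega> x) \<in> restrict_space borel {0..} \<Otimes>\<^sub>M (M \<Otimes>\<^sub>M borel) \<rightarrow>\<^sub>M borel"
  proof (rule borel_measurable_LIMSEQ_metric)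
    show "(\<lambda>(t, \<omega>, x). picard (V \<omega>) (G \<omega>) x n t) \<in> restrict_space borel {0..} \<Otimes>\<^sub>M (M \<Otimes>\<^sub>M borel) \<rightarrow>\<^sub>M borel" for n
      using picard_measurable[OF measurable_flow U_meas F_meas] by (simp add: V_def[abs_def] G_def[abs_def])
    fix p assume "p \<in> space (restrict_space borel {0::real..} \<Otimes>\<^sub>M (M \<Otimes>\<^sub>M (borel :: 'h measure)))"
    then obtain t \<omega> x where p: "p = (t, \<omega>, x)" "0 \<le> t" "\<omega> \<in> space M"
      by (cases p) (auto simp: space_pair_measure space_restrict_space)
    then show "(\<lambda>n. case p of (t, \<omega>, x) \<Rightarrow> picard (V \<omega>) (G \<omega>) x n t) \<longlonglongrightarrow> (case p of (t, \<omega>, x) \<Rightarrow> \<phi> t \<omega> x)"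
      using semilinear_evolution.picard_tendsto[OF evo] by (simp add: \<phi>_def)
  qed
  \<comment> \<open>The fixed point equation at time 0, where the integral runs over a single
    point.\<close>
  have initial: "\<phi> 0 \<omega> x = x" if "\<omega> \<in> space M" for \<omega> x
    using semilinear_evolution.picard_limit_fixpoint[OF evo[OF that], of 0 x] U_0[OF that] flow_zero[OF that]
    by (simp add: \<phi>_def mild_step_def duhamel_0 V_def)
  have cocycle: "\<phi> (t + \<tau>) \<omega> x = \<phi> t (\<theta> \<tau> \<omega>) (\<phi> \<tau> \<omega> x)"
    if \<omega>: "\<omega> \<in> space M" and "0 \<le> t" "0 \<le> \<tau>" for t \<tau> \<omega> x
  proof -
    \<comment> \<open>The time difference is unchanged and \<open>\<theta> (s + \<tau>) \<omega> =
      \<theta> s (\<theta> \<tau> \<omega>)\<close>, so the shifted data are exactly those of the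
      orbit of \<open>\<theta> \<tau> \<omega>\<close>.\<close>
    have "(\<lambda>t s. V \<omega> (t + \<tau>) (s + \<tau>)) = V (\<theta> \<tau> \<omega>)" "(\<lambda>s. G \<omega> (s + \<tau>)) = G (\<theta> \<tau> \<omega>)"
      using flow_add[OF \<omega>] by (auto simp: V_def G_def fun_eq_iff)
    then have "solves_mild_equation (V (\<theta> \<tau> \<omega>)) (G (\<theta> \<tau> \<omega>)) (\<phi> \<tau> \<omega> x) t (\<lambda>r. \<phi> (r + \<tau>) \<omega> x)"
      using semilinear_evolution.solution_shift[OF evo[OF \<omega>]
          semilinear_evolution.picard_limit_solves[OF evo[OF \<omega>], where T="t + \<tau>" and x=x] \<open>0 \<le> \<tau>\<close>]
      by (simp add: \<phi>_def)
    from semilinear_evolution.solution_unique[OF evo[OF flow_in[OF \<omega>]] this, of t] show ?thesis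
      using \<open>0 \<le> t\<close> by (simp add: \<phi>_def)
  qed
  have cont: "continuous_on UNIV (\<phi> t \<omega>)" if "\<omega> \<in> space M" "0 \<le> t" for t \<omega>
    using semilinear_evolution.picard_limit_lipschitz[OF evo[OF that(1)] that(2)]
    by (auto simp: \<phi>_def intro: lipschitz_on_continuous_on)
  have "continuous_rds M \<theta> \<phi>"
    unfolding continuous_rds_def using meas initial cocycle cont by blast
  moreover have "mild_solution \<theta> U F \<omega> x T (\<lambda>t. \<phi> t \<omega> x)" if "\<omega> \<in> space M" for \<omega> x T
    using semilinear_evolution.picard_limit_solves[OF evo[OF that]] by (simp add: mild_iff[OF that] \<phi>_def)
  moreover have "u t = \<phi> t \<omega> x" if "\<omega> \<in> space M" "mild_solution \<theta> U F \<omega> x T u" "t \<in> {0..T}" for \<omega> x T u t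
    using semilinear_evolution.solution_unique[OF evo[OF that(1)] _ that(3)] that(2)
    by (simp add: mild_iff[OF that(1)] \<phi>_def)
  ultimately show ?thesis
    by blast
qed

end
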